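(* Let $n\geq 2$ be an integer. The following two statements are equivalent: (a) every homogeneous polynomial $f\in\mathbb{C}[x_1,\ldots,x_n]$ of degree $3$ satisfying $H(f)=\alpha\, x_1x_2\cdots x_n$ for some $\alpha\in\mathbb{C}$, $\alpha\neq 0$, is of the form $f=\alpha_1x_1^3+\cdots+\alpha_nx_n^3$ for some constants $\alpha_1,\ldots,\alpha_n\in\mathbb{C}$; (b) $n=2$.
   Context: For a homogeneous polynomial $f\in \mathbb{C}[x_1,\ldots,x_n]$, $\mathrm{Hess}(f)=\left(\frac{\partial^2 f}{\partial x_i\partial x_j}\right)_{1\le i,j\le n}$ is the Hessian matrix and $H(f)=\det(\mathrm{Hess}(f))$. *)

theory Defs
  imports "HOL-Library.Poly_Mapping" "Jordan_Normal_Form.Determinant"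
begin

text \<open>
  Polynomials in countably many variables \<open>x\<^sub>0, x\<^sub>1, \<dots>\<close> are finitely supported maps from exponent
  vectors to coefficients, with the convolution product provided by \<^theory>\<open>HOL-Library.Poly_Mapping\<close>.
  The ring \<open>\<complex>[x\<^sub>1,\<dots>,x\<^sub>n]\<close> is represented by the polynomials involving only the variables with
  indices in \<open>{..<n}\<close>; thus variable \<open>i\<close> here is \<open>x\<close> with subscript \<open>i + 1\<close> in the usual numbering.
\<close>

type_synonym 'a mpoly = "(nat \<Rightarrow>\<^sub>0 nat) \<Rightarrow>\<^sub>0 'a"

definition Const :: "'a::zero \<Rightarrow> 'a mpoly" where
  "Const c = Poly_Mapping.single 0 c"

definition Var :: "nat \<Rightarrow> 'a::zero_neq_one mpoly" where
  "Var i = Poly_Mapping.single (Poly_Mapping.single i 1) 1"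

definition mpolys :: "nat \<Rightarrow> 'a::zero mpoly set" where
  "mpolys n = {f. \<forall>m \<in> Poly_Mapping.keys f. Poly_Mapping.keys m \<subseteq> {..<n}}"

definition total_degree :: "(nat \<Rightarrow>\<^sub>0 nat) \<Rightarrow> nat" where
  "total_degree m = (\<Sum>i\<in>Poly_Mapping.keys m. Poly_Mapping.lookup m i)"

text \<open>The zero polynomial counts as homogeneous of every degree.\<close>

definition homogeneous :: "nat \<Rightarrow> 'a::zero mpoly \<Rightarrow> bool" where
  "homogeneous d f \<longleftrightarrow> (\<forall>m \<in> Poly_Mapping.keys f. total_degree m = d)"

text \<open>
  Formal partial derivative, monomial by monomial. The subtraction of exponent vectors truncates
  when the \<open>i\<close>-th exponent is 0, but then the coefficient vanishes.
\<close>

definition partial_deriv :: "nat \<Rightarrow> 'a::comm_semiring_1 mpoly \<Rightarrow> 'a mpoly" where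
  "partial_deriv i f =
     (\<Sum>m\<in>Poly_Mapping.keys f. Poly_Mapping.single (m - Poly_Mapping.single i 1)
        (of_nat (Poly_Mapping.lookup m i) * Poly_Mapping.lookup f m))"

lemma lookup_partial_deriv:
  "Poly_Mapping.lookup (partial_deriv i f) m =
     of_nat (Suc (Poly_Mapping.lookup m i)) * Poly_Mapping.lookup f (m + Poly_Mapping.single i 1)"
proof -
  let ?e = "Poly_Mapping.single i (1::nat)"
  have eq: "(of_nat (Poly_Mapping.lookup k i) * Poly_Mapping.lookup f k when k - ?e = m) =
        (of_nat (Poly_Mapping.lookup k i) * Poly_Mapping.lookup f k when k = m + ?e)" for k
  proof (cases "Poly_Mapping.lookup k i = 0")
    case True
    then show ?thesis by (auto simp: when_def lookup_add)
  next
    case False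
    have "k - ?e = m \<longleftrightarrow> k = m + ?e"
    proof
      assume "k - ?e = m"
      moreover have "k - ?e + ?e = k"
        using False by (intro poly_mapping_eqI) (auto simp: lookup_add lookup_minus lookup_single when_def)
      ultimately show "k = m + ?e" by simp
    qed simp
    then show ?thesis by simp
  qed
  have "Poly_Mapping.lookup (partial_deriv i f) m =
      (\<Sum>k\<in>Poly_Mapping.keys f. (of_nat (Poly_Mapping.lookup k i) * Poly_Mapping.lookup f k when k = m + ?e))"
    by (simp add: partial_deriv_def lookup_sum lookup_single eq [unfolded One_nat_def])
  also have "\<dots> = of_nat (Suc (Poly_Mapping.lookup m i)) * Poly_Mapping.lookup f (m + ?e)"
    by (auto simp: when_def sum.delta lookup_add lookup_single in_keys_iff)
  finally show ?thesis .
qed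

definition Hess :: "nat \<Rightarrow> 'a::comm_ring_1 mpoly \<Rightarrow> 'a mpoly mat" where
  "Hess n f = mat n n (\<lambda>(i, j). partial_deriv i (partial_deriv j f))"

definition Hessian_det :: "nat \<Rightarrow> 'a::comm_ring_1 mpoly \<Rightarrow> 'a mpoly" where
  "Hessian_det n f = det (Hess n f)"

end

theory Submission imports Defs begin

text \<open>
  For \<open>n = 2\<close> call the variables \<open>x\<close> and \<open>y\<close> and write \<open>f = a x\<^sup>3 + b x\<^sup>2y + c xy\<^sup>2 + d y\<^sup>3\<close>. Up to the factor 4, the Hessian determinant is
  the quadratic form \<open>(3ac - b\<^sup>2) x\<^sup>2 + (9ad - bc) xy + (3bd - c\<^sup>2) y\<^sup>2\<close>. If it is a nonzero multiple of
  \<open>xy\<close>, then \<open>3ac = b\<^sup>2\<close> and \<open>3bd = c\<^sup>2\<close>; multiplying these two equations gives \<open>bc (9ad - bc) = 0\<close>,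
  and since the second factor is nonzero, \<open>b\<close> or \<open>c\<close> vanishes. By the same two equations both vanish,
  so that \<open>f\<close> is a sum of cubes (lemma \<open>binary_cubic_Hessian_xy_imp_diagonal\<close>).

  For \<open>n \<ge> 3\<close> diagonality fails because the cubic \<open>x\<^sub>0x\<^sub>1x\<^sub>2\<close> already has Hessian determinant
  \<open>2x\<^sub>0x\<^sub>1x\<^sub>2\<close>. Adding \<open>x\<^sub>k\<^sup>3\<close> for every further variable makes the Hessian matrix block diagonal and
  contributes the factor \<open>6x\<^sub>k\<close> to its determinant (lemma \<open>Hessian_det_xyz_plus_cubes\<close>). The
  resulting polynomial is not a combination of cubes, because \<open>\<partial>\<^sub>0\<partial>\<^sub>1\<close> kills all cubes but maps it to
  \<open>x\<^sub>2\<close>.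
\<close>

section \<open>Formal derivatives\<close>

lemma partial_deriv_zero [simp]: "partial_deriv i 0 = 0"
  by (simp add: partial_deriv_def)

lemma partial_deriv_add [simp]: "partial_deriv i (f + g) = partial_deriv i f + partial_deriv i g"
  by (rule poly_mapping_eqI) (simp only: lookup_partial_deriv lookup_add distrib_left)

lemma partial_deriv_sum: "partial_deriv i (sum f A) = (\<Sum>k\<in>A. partial_deriv i (f k))"
  by (induction A rule: infinite_finite_induct) auto

lemma partial_deriv_single:
  "partial_deriv i (Poly_Mapping.single m c) =
     Poly_Mapping.single (m - Poly_Mapping.single i 1) (of_nat (Poly_Mapping.lookup m i) * c)"
  by (simp add: partial_deriv_def)

lemma poly_mapping_sum_monomials:
  "(\<Sum>m\<in>Poly_Mapping.keys f. Poly_Mapping.single m (Poly_Mapping.lookup f m)) = f"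
  by (rule poly_mapping_eqI) (auto simp: lookup_sum lookup_single when_def sum.delta in_keys_iff)

lemma mpoly_induct [case_names zero single_add]:
  fixes f :: "'a::comm_monoid_add mpoly"
  assumes "P 0" and "\<And>m c g. P g \<Longrightarrow> P (Poly_Mapping.single m c + g)"
  shows "P f"
proof -
  have "P (\<Sum>m\<in>A. Poly_Mapping.single m (Poly_Mapping.lookup f m))" if "finite A" for A
    using that by induction (auto intro: assms)
  from this[OF finite_keys[of f]] show ?thesis
    by (simp add: poly_mapping_sum_monomials)
qed

text \<open>
  Both summands on the right are multiples of the same monomial, with coefficients proportional to the
  exponents of variable \<open>i\<close> in the two factors, and exponents add up. Truncated subtraction only
  interferes when an exponent is 0, and then the summand is 0.
\<close>

lemma partial_deriv_mult_single:
  fixes a b :: "'a::comm_semiring_1"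
  shows "partial_deriv i (Poly_Mapping.single k a * Poly_Mapping.single l b) =
     partial_deriv i (Poly_Mapping.single k a) * Poly_Mapping.single l b +
     Poly_Mapping.single k a * partial_deriv i (Poly_Mapping.single l b)"
proof -
  let ?e = "Poly_Mapping.single i (1::nat)"
  have shift: "k - ?e + l = k + l - ?e" if "Poly_Mapping.lookup k i \<noteq> 0" for k l :: "nat \<Rightarrow>\<^sub>0 nat"
    using that by (intro poly_mapping_eqI) (auto simp: lookup_add lookup_minus lookup_single when_def)
  have left: "partial_deriv i (Poly_Mapping.single k a) * Poly_Mapping.single l b =
      Poly_Mapping.single (k + l - ?e) (of_nat (Poly_Mapping.lookup k i) * (a * b))"
    by (cases "Poly_Mapping.lookup k i = 0")
       (simp_all add: partial_deriv_single mult_single shift[unfolded One_nat_def] mult.assoc)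
  have right: "Poly_Mapping.single k a * partial_deriv i (Poly_Mapping.single l b) =
      Poly_Mapping.single (k + l - ?e) (of_nat (Poly_Mapping.lookup l i) * (a * b))"
    using shift[of l k]
    by (cases "Poly_Mapping.lookup l i = 0")
       (simp_all add: partial_deriv_single mult_single ac_simps)
  show ?thesis
    unfolding left right
    by (simp add: mult_single partial_deriv_single lookup_add distrib_right
        flip: Poly_Mapping.single_add)
qed

text \<open>
  The Leibniz rule is bilinear in the two factors, so it follows from the case of two monomials. With
  it the simplifier computes derivatives of polynomials written as products of variables.
\<close>

lemma partial_deriv_mult [simp]:
  fixes f g :: "'a::comm_semiring_1 mpoly"
  shows "partial_deriv i (f * g) = partial_deriv i f * g + f * partial_deriv i g"
proof (induction f rule: mpoly_induct)
  case zero
  then show ?case by simp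
next
  case (single_add m c f)
  have "partial_deriv i (Poly_Mapping.single m c * g) =
      partial_deriv i (Poly_Mapping.single m c) * g + Poly_Mapping.single m c * partial_deriv i g"
    by (induction g rule: mpoly_induct)
       (simp_all add: distrib_left partial_deriv_mult_single ac_simps)
  with single_add show ?case by (simp add: distrib_right add_ac)
qed

lemma partial_deriv_Const [simp]: "partial_deriv i (Const c) = 0"
  by (simp add: Const_def partial_deriv_single)

lemma partial_deriv_numeral [simp]: "partial_deriv i (numeral k :: 'a::comm_semiring_1 mpoly) = 0"
  using partial_deriv_Const[of i "numeral k :: 'a"] by (simp add: Const_def)

lemma partial_deriv_one [simp]: "partial_deriv i (1 :: 'a::comm_semiring_1 mpoly) = 0"
  using partial_deriv_Const[of i "1 :: 'a"] by (simp add: Const_def)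

lemma partial_deriv_Var [simp]: "partial_deriv i (Var j) = (if i = j then 1 else 0)"
  by (auto simp: Var_def partial_deriv_single lookup_single when_def)

lemma partial_deriv2_cube:
  fixes k :: nat
  shows "partial_deriv i (partial_deriv j (Var k ^ 3 :: 'a::comm_semiring_1 mpoly)) =
    (if i = k \<and> j = k then 6 * Var k else 0)"
proof -
  \<comment> \<open>The right-hand side is the form in which the simplifier leaves the second derivative of a cube.\<close>
  have "6 * x = 2 * x + (x + (x + (x + x)))" for x :: "'a mpoly"
    by (simp only: numeral.simps distrib_right mult_1_left add.assoc)
  then show ?thesis
    by (simp add: power3_eq_cube distrib_left add.assoc)
qed

section \<open>Coefficients and degrees\<close>

lemma Const_mult: "Const (a * b) = Const a * Const b"
  by (simp add: Const_def mult_single)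

lemma Const_diff: "Const (a - b) = Const a - Const b"
  by (simp add: Const_def single_diff)

lemma Const_numeral [simp]: "Const (numeral k) = numeral k"
  by (simp add: Const_def)

lemma Const_power: "Const (a ^ k) = Const (a :: 'a::comm_semiring_1) ^ k"
  by (induction k) (simp_all add: Const_mult, simp add: Const_def)

lemma Var_power: "Var i ^ k = Poly_Mapping.single (Poly_Mapping.single i k) (1 :: 'a::comm_semiring_1)"
  by (induction k) (simp_all add: Var_def mult_single flip: Poly_Mapping.single_add)

lemma Var_neq_zero: "Var i \<noteq> 0"
proof
  assume "Var i = (0 :: 'a mpoly)"
  then have "Poly_Mapping.keys (Var i :: 'a mpoly) = {}" by simp
  then show False by (simp add: Var_def)
qed

lemma binary_quadratic_form_eqD:
  fixes p q r p' q' r' :: "'a::comm_semiring_1"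
  assumes "Const p * Var 0 ^ 2 + Const q * (Var 0 * Var 1) + Const r * Var 1 ^ 2 =
    Const p' * Var 0 ^ 2 + Const q' * (Var 0 * Var 1) + Const r' * Var 1 ^ 2" (is "?F = ?G")
  shows "p = p'" "q = q'" "r = r'"
proof -
  let ?s = "Poly_Mapping.single :: nat \<Rightarrow> nat \<Rightarrow> nat \<Rightarrow>\<^sub>0 nat"
  define xx xy yy where exps: "xx = ?s 0 2" "xy = ?s 0 1 + ?s 1 1" "yy = ?s 1 2"
  have "Poly_Mapping.lookup xx 0 = 2" "Poly_Mapping.lookup xy 0 = 1" "Poly_Mapping.lookup yy 0 = 0"
    by (simp_all add: exps lookup_add lookup_single lookup_numeral)
  then have distinct: "xx \<noteq> xy" "xx \<noteq> yy" "xy \<noteq> yy"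
    by auto
  have expand: "Const u * Var 0 ^ 2 + Const v * (Var 0 * Var 1) + Const w * Var 1 ^ 2 =
      Poly_Mapping.single xx u + Poly_Mapping.single xy v + Poly_Mapping.single yy w" for u v w :: 'a
    \<comment> \<open>Index 0 is the zero of the monoid of indices, so those two rules would turn \<open>?s 0 2\<close> and \<open>?s 0 1\<close>
      into numerals of the exponent type, which no longer match the exponents of the variables.\<close>
    unfolding Var_power exps by (simp add: Const_def Var_def mult_single del: single_numeral single_one)
  have "Poly_Mapping.lookup ?F m = Poly_Mapping.lookup ?G m" for m
    using assms by simp
  from this[of xx] this[of xy] this[of yy] distinct
  show "p = p'" "q = q'" "r = r'"
    unfolding expand by (simp_all add: lookup_add lookup_single distinct[symmetric])
qed

text \<open>
  Summing over any finite superset of the support allows the degrees of several monomials to be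
  computed over one common index set.
\<close>

lemma total_degree_eq_sum:
  assumes "Poly_Mapping.keys m \<subseteq> A" "finite A"
  shows "total_degree m = (\<Sum>i\<in>A. Poly_Mapping.lookup m i)"
  unfolding total_degree_def using assms
  by (intro sum.mono_neutral_left) (auto simp: in_keys_iff)

lemma total_degree_add: "total_degree (m + k) = total_degree m + total_degree k"
proof -
  let ?A = "Poly_Mapping.keys m \<union> Poly_Mapping.keys k"
  have "total_degree x = (\<Sum>i\<in>?A. Poly_Mapping.lookup x i)" if "Poly_Mapping.keys x \<subseteq> ?A" for x
    using that by (intro total_degree_eq_sum) auto
  from this[of m] this[of k] this[of "m + k"] show ?thesis
    using Poly_Mapping.keys_add[of m k] by (simp add: lookup_add sum.distrib)
qed

lemma homogeneous_add: "homogeneous d f \<Longrightarrow> homogeneous d g \<Longrightarrow> homogeneous d (f + g)"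
  unfolding homogeneous_def using Poly_Mapping.keys_add[of f g] by blast

lemma homogeneous_sum: "(\<And>i. i \<in> A \<Longrightarrow> homogeneous d (f i)) \<Longrightarrow> homogeneous d (sum f A)"
  unfolding homogeneous_def using keys_sum[of f A] by blast

lemma homogeneous_mult: "homogeneous d f \<Longrightarrow> homogeneous e g \<Longrightarrow> homogeneous (d + e) (f * g)"
  unfolding homogeneous_def using keys_mult[of f g] by (force simp: total_degree_add)

lemma homogeneous_Var: "homogeneous 1 (Var i)"
  by (simp add: homogeneous_def Var_def total_degree_def)

lemma mpolys_add: "f \<in> mpolys n \<Longrightarrow> g \<in> mpolys n \<Longrightarrow> f + g \<in> mpolys n"
  unfolding mpolys_def using Poly_Mapping.keys_add[of f g] by blast

lemma mpolys_sum: "(\<And>i. i \<in> A \<Longrightarrow> f i \<in> mpolys n) \<Longrightarrow> sum f A \<in> mpolys n"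
  unfolding mpolys_def using keys_sum[of f A] by blast

lemma mpolys_mult: "f \<in> mpolys n \<Longrightarrow> g \<in> mpolys n \<Longrightarrow> f * g \<in> mpolys n"
  unfolding mpolys_def using keys_mult[of f g] by (force dest!: subsetD[OF Poly_Mapping.keys_add])

lemma mpolys_Var: "i < n \<Longrightarrow> Var i \<in> mpolys n"
  by (simp add: mpolys_def Var_def)

section \<open>Binary cubics\<close>

text \<open>
  A monomial of degree 3 in two variables is determined by its exponent \<open>k \<le> 3\<close> in the second one, so
  the support of \<open>f\<close> lies among four monomials.
\<close>

lemma binary_cubic_normal_form:
  fixes f :: "'a::comm_semiring_1 mpoly"
  assumes "f \<in> mpolys 2" "homogeneous 3 f"
  obtains a b c d where "f = Const a * Var 0 ^ 3 + Const b * (Var 0 ^ 2 * Var 1) +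
    Const c * (Var 0 * Var 1 ^ 2) + Const d * Var 1 ^ 3"
proof -
  define mon :: "nat \<Rightarrow> nat \<Rightarrow>\<^sub>0 nat"
    where "mon k = Poly_Mapping.single 0 (3 - k) + Poly_Mapping.single 1 k" for k
  have mon_eq: "Poly_Mapping.single (mon k) c = Const c * (Var 0 ^ (3 - k) * Var 1 ^ k)"
    for k and c :: 'a
    by (simp add: Var_power mon_def) (simp add: Const_def mult_single)
  have "m \<in> mon ` {..3}" if "m \<in> Poly_Mapping.keys f" for m
  proof -
    have keys: "Poly_Mapping.keys m \<subseteq> {..<2}" and "total_degree m = 3"
      using assms that by (auto simp: mpolys_def homogeneous_def)
    then have deg: "Poly_Mapping.lookup m 0 + Poly_Mapping.lookup m 1 = 3"
      using total_degree_eq_sum[OF keys] by (simp add: numeral_2_eq_2)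
    have "m = mon (Poly_Mapping.lookup m 1)"
    proof (rule poly_mapping_eqI)
      fix i
      have "Poly_Mapping.lookup m i = 0" if "i \<noteq> 0" "i \<noteq> 1"
        using keys that by (auto simp: in_keys_iff subset_iff less_2_cases_iff)
      then show "Poly_Mapping.lookup m i = Poly_Mapping.lookup (mon (Poly_Mapping.lookup m 1)) i"
        using deg by (auto simp: mon_def lookup_add lookup_single when_def)
    qed
    with deg show ?thesis by (metis atMost_iff imageI le_add2)
  qed
  moreover have "inj_on mon {..3}"
  proof (rule inj_onI)
    fix k l assume "mon k = mon l"
    then have "Poly_Mapping.lookup (mon k) 1 = Poly_Mapping.lookup (mon l) 1" by simp
    then show "k = l" by (simp add: mon_def lookup_add lookup_single)
  qed
  ultimately have "f = (\<Sum>k\<le>3. Poly_Mapping.single (mon k) (Poly_Mapping.lookup f (mon k)))"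
    by (subst poly_mapping_sum_monomials[of f, symmetric],
        subst sum.reindex[of mon, unfolded o_def, symmetric])
       (auto intro!: sum.mono_neutral_left simp: in_keys_iff)
  then show ?thesis
    unfolding mon_eq
    by (intro that[of "Poly_Mapping.lookup f (mon 0)" "Poly_Mapping.lookup f (mon 1)"
          "Poly_Mapping.lookup f (mon 2)" "Poly_Mapping.lookup f (mon 3)"])
       (simp add: numeral_3_eq_3 numeral_2_eq_2 ac_simps)
qed

lemma det_2:
  fixes A :: "'a::comm_ring_1 mat"
  assumes "A \<in> carrier_mat 2 2"
  shows "det A = A $$ (0,0) * A $$ (1,1) - A $$ (0,1) * A $$ (1,0)"
  using assms
  by (subst laplace_expansion_row[of _ 2 0])
     (auto simp: cofactor_def mat_delete_def det_single numeral_2_eq_2)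

text \<open>
  The second derivatives are \<open>6ax + 2by\<close>, \<open>2bx + 2cy\<close> and \<open>2cx + 6dy\<close>.
\<close>

lemma Hessian_det_binary_cubic:
  fixes a b c d :: "'a::comm_ring_1"
  shows "Hessian_det 2 (Const a * Var 0 ^ 3 + Const b * (Var 0 ^ 2 * Var 1) +
      Const c * (Var 0 * Var 1 ^ 2) + Const d * Var 1 ^ 3) =
    Const (4 * (3 * a * c - b ^ 2)) * Var 0 ^ 2 + Const (4 * (9 * a * d - b * c)) * (Var 0 * Var 1) +
    Const (4 * (3 * b * d - c ^ 2)) * Var 1 ^ 2"
  by (simp add: Hessian_det_def det_2 Hess_def partial_deriv2_cube)
     (simp add: Const_mult Const_diff power2_eq_square algebra_simps)

text \<open>
  The vanishing of the coefficients of \<open>x\<^sup>2\<close> and \<open>y\<^sup>2\<close> in the determinant makes \<open>bc\<close> times the coefficient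
  of \<open>xy\<close> vanish too, which forces \<open>b = c = 0\<close>. Characteristic 0 allows the common factor 4
  of the coefficients to be cancelled.
\<close>

lemma binary_cubic_Hessian_xy_imp_diagonal:
  fixes f :: "'a::{idom, ring_char_0} mpoly"
  assumes "f \<in> mpolys 2" "homogeneous 3 f"
    and "\<alpha> \<noteq> 0" "Hessian_det 2 f = Const \<alpha> * (Var 0 * Var 1)"
  shows "\<exists>a d. f = Const a * Var 0 ^ 3 + Const d * Var 1 ^ 3"
proof -
  obtain a b c d where f: "f = Const a * Var 0 ^ 3 + Const b * (Var 0 ^ 2 * Var 1) +
      Const c * (Var 0 * Var 1 ^ 2) + Const d * Var 1 ^ 3"
    using binary_cubic_normal_form[OF assms(1,2)] .
  have "Const (4 * (3 * a * c - b ^ 2)) * Var 0 ^ 2 +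
      Const (4 * (9 * a * d - b * c)) * (Var 0 * Var 1) + Const (4 * (3 * b * d - c ^ 2)) * Var 1 ^ 2 =
      Const 0 * Var 0 ^ 2 + Const \<alpha> * (Var 0 * Var 1) + Const 0 * Var 1 ^ 2"
    using assms(4) unfolding f Hessian_det_binary_cubic by (simp add: Const_def)
  note coeffs = binary_quadratic_form_eqD[OF this]
  have x2: "3 * a * c = b ^ 2" and y2: "3 * b * d = c ^ 2" and xy: "9 * a * d - b * c \<noteq> 0"
    using coeffs \<open>\<alpha> \<noteq> 0\<close> by (auto simp: mult.assoc)
  have "b * c * (9 * a * d - b * c) = (3 * a * c) * (3 * b * d) - b ^ 2 * c ^ 2"
    by (simp add: algebra_simps power2_eq_square)
  then have "b * c * (9 * a * d - b * c) = 0"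
    unfolding x2 y2 by simp
  with xy have "b = 0 \<or> c = 0" by simp
  with x2 y2 have "b = 0" "c = 0" by auto
  then show ?thesis unfolding f by (auto simp: Const_def)
qed

section \<open>A non-diagonal cubic in at least three variables\<close>

definition xyz_plus_cubes :: "nat \<Rightarrow> 'a::comm_semiring_1 mpoly" where
  "xyz_plus_cubes n = Var 0 * Var 1 * Var 2 + (\<Sum>k = 3..<n. Var k ^ 3)"

lemma xyz_plus_cubes_mpolys: "n \<ge> 3 \<Longrightarrow> xyz_plus_cubes n \<in> mpolys n"
  by (auto simp: xyz_plus_cubes_def power3_eq_cube
      intro!: mpolys_add mpolys_mult mpolys_sum mpolys_Var)

lemma xyz_plus_cubes_homogeneous: "homogeneous 3 (xyz_plus_cubes n :: 'a::comm_semiring_1 mpoly)"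
proof -
  have "homogeneous 3 (Var i * Var j * Var k :: 'a mpoly)" for i j k
    using homogeneous_mult[OF homogeneous_mult[OF homogeneous_Var homogeneous_Var] homogeneous_Var]
    by (simp add: numeral_3_eq_3)
  then show ?thesis
    by (auto simp: xyz_plus_cubes_def power3_eq_cube intro!: homogeneous_add homogeneous_sum)
qed

lemma partial_deriv2_xyz_plus_cubes:
  "partial_deriv i (partial_deriv j (xyz_plus_cubes n :: 'a::comm_semiring_1 mpoly)) =
     partial_deriv i (partial_deriv j (Var 0 * Var 1 * Var 2)) +
     (if i = j \<and> 3 \<le> i \<and> i < n then 6 * Var i else 0)"
proof -
  have "(\<Sum>k = 3..<n. if i = k \<and> j = k then 6 * Var k else 0) =
      (\<Sum>k = 3..<n. if k = i then (if i = j then 6 * Var i else 0) else 0 :: 'a mpoly)"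
    by (rule sum.cong) auto
  then have "(\<Sum>k = 3..<n. if i = k \<and> j = k then 6 * Var k else 0) =
      (if i = j \<and> 3 \<le> i \<and> i < n then 6 * Var i else 0 :: 'a mpoly)"
    by (simp add: sum.delta)
  then show ?thesis
    unfolding xyz_plus_cubes_def partial_deriv_add partial_deriv_sum partial_deriv2_cube by simp
qed

text \<open>
  Only the two cyclic permutations of three indices have no fixed point, and both are even.
\<close>

lemma det_3_zero_diagonal:
  fixes A :: "'a::comm_ring_1 mat"
  assumes "A \<in> carrier_mat 3 3" and "\<And>i. i < 3 \<Longrightarrow> A $$ (i,i) = 0"
  shows "det A = A $$ (0,1) * A $$ (1,2) * A $$ (2,0) + A $$ (0,2) * A $$ (1,0) * A $$ (2,1)"
proof -
  have dims: "dim_row A = 3" "dim_col A = 3" using assms(1) by auto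
  show ?thesis
    using assms(2)[of 0] assms(2)[of 1] assms(2)[of 2] dims
    by (subst laplace_expansion_row[OF assms(1), of 0])
       (simp_all add: cofactor_def det_2 mat_delete_def numeral_3_eq_3 numeral_2_eq_2 algebra_simps)
qed

text \<open>
  The Hessian matrix splits into the block of \<open>x\<^sub>0x\<^sub>1x\<^sub>2\<close>, which has zero diagonal and entries
  \<open>x\<^sub>0, x\<^sub>1, x\<^sub>2\<close> off it, and a diagonal block with entries \<open>6x\<^sub>k\<close> for \<open>k \<ge> 3\<close>.
\<close>

lemma Hessian_det_xyz_plus_cubes:
  assumes "n \<ge> 3"
  shows "Hessian_det n (xyz_plus_cubes n :: 'a::idom mpoly) =
    Const (2 * 6 ^ (n - 3)) * (\<Prod>i<n. Var i)"
proof -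
  define h :: "nat \<times> nat \<Rightarrow> 'a mpoly"
    where "h = (\<lambda>(i, j). partial_deriv i (partial_deriv j (xyz_plus_cubes n)))"
  define D :: "'a mpoly mat" where "D = mat_diag (n - 3) (\<lambda>k. 6 * Var (k + 3))"
  have "Hess n (xyz_plus_cubes n) = four_block_mat (mat 3 3 h) (0\<^sub>m 3 (n - 3)) (0\<^sub>m (n - 3) 3) D"
    using assms
    by (intro eq_matI)
       (auto simp: Hess_def four_block_mat_def h_def D_def mat_diag_def partial_deriv2_xyz_plus_cubes)
  then have "Hessian_det n (xyz_plus_cubes n) = det (mat 3 3 h) * det D"
    unfolding Hessian_det_def
    by (simp add: det_four_block_mat_lower_left_zero[of _ 3 _ "n - 3"] D_def)
  also have "det (mat 3 3 h) = 2 * (Var 0 * Var 1 * Var 2)"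
    by (subst det_3_zero_diagonal)
       (auto simp: h_def partial_deriv2_xyz_plus_cubes algebra_simps)
  also have "det D = prod_list (diag_mat D)"
    by (rule det_upper_triangular[of _ "n - 3"]) (auto simp: D_def mat_diag_def)
  also have "\<dots> = (\<Prod>k<n - 3. 6 * Var (k + 3))"
    by (simp add: prod_list_diag_prod D_def mat_diag_def atLeast0LessThan)
  also have "\<dots> = 6 ^ (n - 3) * (\<Prod>k<n - 3. Var (k + 3))"
    by (simp add: prod.distrib)
  finally have eq: "Hessian_det n (xyz_plus_cubes n :: 'a mpoly) =
    2 * 6 ^ (n - 3) * (Var 0 * Var 1 * Var 2 * (\<Prod>k<n - 3. Var (k + 3)))"
    by (simp add: ac_simps)
  obtain m where n: "n = 3 + m" using assms le_Suc_ex by blast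
  have "(\<Prod>i<n. Var i :: 'a mpoly) = Var 0 * Var 1 * Var 2 * (\<Prod>k<n - 3. Var (k + 3))"
    unfolding n by (induction m) (simp_all add: numeral_3_eq_3 numeral_2_eq_2 ac_simps)
  with eq show ?thesis by (simp add: Const_mult Const_power)
qed

text \<open>
  The mixed derivative \<open>\<partial>\<^sub>0\<partial>\<^sub>1\<close> separates the two sides: it gives \<open>x\<^sub>2\<close> on the left and 0 on every cube.
\<close>

lemma xyz_plus_cubes_not_diagonal:
  fixes a :: "nat \<Rightarrow> 'a::comm_semiring_1"
  shows "xyz_plus_cubes n \<noteq> (\<Sum>i<n. Const (a i) * Var i ^ 3)"
proof
  assume "xyz_plus_cubes n = (\<Sum>i<n. Const (a i) * Var i ^ 3)"
  then have "partial_deriv 0 (partial_deriv 1 (xyz_plus_cubes n)) =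
      partial_deriv 0 (partial_deriv 1 (\<Sum>i<n. Const (a i) * Var i ^ 3))"
    by simp
  moreover have "partial_deriv 0 (partial_deriv 1 (xyz_plus_cubes n)) = (Var 2 :: 'a mpoly)"
    by (simp add: partial_deriv2_xyz_plus_cubes)
  moreover have "partial_deriv 0 (partial_deriv 1 (\<Sum>i<n. Const (a i) * Var i ^ 3)) = 0"
    by (auto simp: partial_deriv_sum partial_deriv2_cube power3_eq_cube intro!: sum.neutral)
  ultimately show False using Var_neq_zero[of 2] by metis
qed

theorem corollary2p5:
  fixes n :: nat
  assumes "n \<ge> 2"
  shows "(\<forall>f :: complex mpoly.
            f \<in> mpolys n \<and> homogeneous 3 f \<and>
            (\<exists>\<alpha>. \<alpha> \<noteq> 0 \<and> Hessian_det n f = Const \<alpha> * (\<Prod>i<n. Var i)) \<longrightarrow>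
            (\<exists>a :: nat \<Rightarrow> complex. f = (\<Sum>i<n. Const (a i) * Var i ^ 3)))
         \<longleftrightarrow> n = 2"
proof
  assume diagonal: "\<forall>f :: complex mpoly.
            f \<in> mpolys n \<and> homogeneous 3 f \<and>
            (\<exists>\<alpha>. \<alpha> \<noteq> 0 \<and> Hessian_det n f = Const \<alpha> * (\<Prod>i<n. Var i)) \<longrightarrow>
            (\<exists>a :: nat \<Rightarrow> complex. f = (\<Sum>i<n. Const (a i) * Var i ^ 3))"
  show "n = 2"
  proof (rule ccontr)
    assume "n \<noteq> 2"
    with assms have n: "n \<ge> 3" by simp
    have "(2 * 6 ^ (n - 3) :: complex) \<noteq> 0" by simp
    with diagonal xyz_plus_cubes_mpolys[OF n] xyz_plus_cubes_homogeneous Hessian_det_xyz_plus_cubes[OF n]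
    obtain a :: "nat \<Rightarrow> complex" where "xyz_plus_cubes n = (\<Sum>i<n. Const (a i) * Var i ^ 3)"
      by blast
    with xyz_plus_cubes_not_diagonal show False by blast
  qed
next
  assume n: "n = 2"
  show "\<forall>f :: complex mpoly.
            f \<in> mpolys n \<and> homogeneous 3 f \<and>
            (\<exists>\<alpha>. \<alpha> \<noteq> 0 \<and> Hessian_det n f = Const \<alpha> * (\<Prod>i<n. Var i)) \<longrightarrow>
            (\<exists>a :: nat \<Rightarrow> complex. f = (\<Sum>i<n. Const (a i) * Var i ^ 3))"
  proof (intro allI impI)
    fix f :: "complex mpoly"
    assume "f \<in> mpolys n \<and> homogeneous 3 f \<and>
            (\<exists>\<alpha>. \<alpha> \<noteq> 0 \<and> Hessian_det n f = Const \<alpha> * (\<Prod>i<n. Var i))"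
    then obtain \<alpha> where "f \<in> mpolys 2" "homogeneous 3 f" "\<alpha> \<noteq> 0"
      "Hessian_det 2 f = Const \<alpha> * (Var 0 * Var 1)"
      unfolding n by (auto simp: numeral_2_eq_2)
    then obtain a d where "f = Const a * Var 0 ^ 3 + Const d * Var 1 ^ 3"
      using binary_cubic_Hessian_xy_imp_diagonal by blast
    then have "f = (\<Sum>i<n. Const (if i = 0 then a else d) * Var i ^ 3)"
      by (simp add: n numeral_2_eq_2)
    then show "\<exists>a :: nat \<Rightarrow> complex. f = (\<Sum>i<n. Const (a i) * Var i ^ 3)"
      by (rule exI[of _ "\<lambda>i. if i = 0 then a else d"])
  qed
qed

end
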